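(* Let $F\colon \mathcal{C}\to\mathcal{D}$ be left adjoint to $G\colon\mathcal{D}\to\mathcal{C}$, with unit $\eta\colon \mathrm{Id}\Rightarrow GF$ and counit $\varepsilon\colon FG\Rightarrow\mathrm{Id}$. Let $H$ be an endofunctor on $\mathcal{C}$, $L$ an endofunctor on $\mathcal{D}$, and $\rho\colon HG\Rightarrow GL$ a natural transformation. Suppose $L$ has a final coalgebra $\zeta\colon\Psi\xrightarrow{\cong}L(\Psi)$. Then for every $H$-coalgebra $c\colon X\to H(X)$ there is a unique coalgebra-to-algebra morphism $c^\dagger\colon X\to G(\Psi)$ from $(X,c)$ to the $H$-algebra $G(\zeta^{-1})\circ\rho_\Psi\colon HG(\Psi)\to G(\Psi)$, i.e. a unique $c^\dagger$ with $c^\dagger = G(\zeta^{-1})\circ\rho_\Psi\circ H(c^\dagger)\circ c$. Moreover, the adjoint transpose $\overline{c^\dagger}\colon F(X)\to\Psi$ of $c^\dagger$ is the unique coalgebra-to-algebra morphism from the $L$-coalgebra $(\rho_2)_X\circ F(c)\colon F(X)\to LF(X)$ to the $L$-algebra $\zeta^{-1}\colon L(\Psi)\to\Psi$; equivalently, $\overline{c^\dagger}$ is the unique $L$-coalgebra homomorphism from $(F(X),(\rho_2)_X\circ F(c))$ to the final coalgebra $(\Psi,\zeta)$.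
   Context: For an endofunctor $K$ on a category, a coalgebra-to-algebra morphism from a $K$-coalgebra $c\colon X\to K(X)$ to a $K$-algebra $a\colon K(\Theta)\to\Theta$ is a map $f\colon X\to\Theta$ with $f=a\circ K(f)\circ c$. The natural transformation $\rho_2\colon FH\Rightarrow LF$ (the mate of $\rho$) is defined by $\rho_2=\varepsilon LF\circ F\rho F\circ FH\eta$. Adjoint transposition is the bijection $\mathcal{D}(F(X),Y)\cong\mathcal{C}(X,G(Y))$ of the adjunction. *)

theory Defs
  imports Main
begin

record ('o, 'a) category_data =
  Obj :: "'o set"
  Arr :: "'a set"
  Dom :: "'a \<Rightarrow> 'o"
  Cod :: "'a \<Rightarrow> 'o"
  Ident :: "'o \<Rightarrow> 'a"
  Comp :: "'a \<Rightarrow> 'a \<Rightarrow> 'a"  (infixr \<open>\<cdot>\<index>\<close> 70)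

definition hom :: "('o, 'a) category_data \<Rightarrow> 'o \<Rightarrow> 'o \<Rightarrow> 'a set" where
  "hom C X Y = {f \<in> Arr C. Dom C f = X \<and> Cod C f = Y}"

text \<open>As usual, \<open>g \<cdot> f\<close> is first \<open>f\<close>, then \<open>g\<close>; its value is unspecified if \<open>f\<close> and \<open>g\<close>
  are not composable.\<close>

locale category =
  fixes C :: "('o, 'a) category_data" (structure)
  assumes Dom_obj: "f \<in> Arr C \<Longrightarrow> Dom C f \<in> Obj C"
    and Cod_obj: "f \<in> Arr C \<Longrightarrow> Cod C f \<in> Obj C"
    and ident_hom: "X \<in> Obj C \<Longrightarrow> Ident C X \<in> hom C X X"
    and comp_hom: "\<lbrakk>f \<in> hom C X Y; g \<in> hom C Y Z\<rbrakk> \<Longrightarrow> g \<cdot> f \<in> hom C X Z"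
    and comp_ident: "f \<in> hom C X Y \<Longrightarrow> f \<cdot> Ident C X = f"
    and ident_comp: "f \<in> hom C X Y \<Longrightarrow> Ident C Y \<cdot> f = f"
    and comp_assoc: "\<lbrakk>f \<in> hom C W X; g \<in> hom C X Y; h \<in> hom C Y Z\<rbrakk>
      \<Longrightarrow> (h \<cdot> g) \<cdot> f = h \<cdot> (g \<cdot> f)"

definition inverse_arrows :: "('o, 'a) category_data \<Rightarrow> 'a \<Rightarrow> 'a \<Rightarrow> bool" where
  "inverse_arrows C f g \<longleftrightarrow> (\<exists>X Y. f \<in> hom C X Y \<and> g \<in> hom C Y X \<and>
     g \<cdot>\<^bsub>C\<^esub> f = Ident C X \<and> f \<cdot>\<^bsub>C\<^esub> g = Ident C Y)"

definition iso :: "('o, 'a) category_data \<Rightarrow> 'a \<Rightarrow> bool" where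
  "iso C f \<longleftrightarrow> (\<exists>g. inverse_arrows C f g)"

definition inv_arr :: "('o, 'a) category_data \<Rightarrow> 'a \<Rightarrow> 'a" where
  "inv_arr C f = (THE g. inverse_arrows C f g)"


record ('o, 'a, 'p, 'b) functor_data =
  omap :: "'o \<Rightarrow> 'p"
  amap :: "'a \<Rightarrow> 'b"

locale cat_functor = C: category C + D: category D
  for C :: "('o, 'a) category_data" and D :: "('p, 'b) category_data" +
  fixes F :: "('o, 'a, 'p, 'b) functor_data"
  assumes omap_obj: "X \<in> Obj C \<Longrightarrow> omap F X \<in> Obj D"
    and amap_hom: "f \<in> hom C X Y \<Longrightarrow> amap F f \<in> hom D (omap F X) (omap F Y)"
    and amap_ident: "X \<in> Obj C \<Longrightarrow> amap F (Ident C X) = Ident D (omap F X)"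
    and amap_comp: "\<lbrakk>f \<in> hom C X Y; g \<in> hom C Y Z\<rbrakk>
      \<Longrightarrow> amap F (g \<cdot>\<^bsub>C\<^esub> f) = amap F g \<cdot>\<^bsub>D\<^esub> amap F f"

definition id_functor :: "('o, 'a, 'o, 'a) functor_data" where
  "id_functor = \<lparr>omap = (\<lambda>X. X), amap = (\<lambda>f. f)\<rparr>"

definition comp_functor ::
  "('p, 'b, 'q, 'c) functor_data \<Rightarrow> ('o, 'a, 'p, 'b) functor_data \<Rightarrow> ('o, 'a, 'q, 'c) functor_data"
  (infixr \<open>\<circ>\<^sub>F\<close> 75) where
  "G \<circ>\<^sub>F F = \<lparr>omap = (\<lambda>X. omap G (omap F X)), amap = (\<lambda>f. amap G (amap F f))\<rparr>"

locale nat_trans = S: cat_functor C D S + T: cat_functor C D T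
  for C :: "('o, 'a) category_data" and D :: "('p, 'b) category_data"
    and S T :: "('o, 'a, 'p, 'b) functor_data" +
  fixes \<tau> :: "'o \<Rightarrow> 'b"
  assumes component_hom: "X \<in> Obj C \<Longrightarrow> \<tau> X \<in> hom D (omap S X) (omap T X)"
    and naturality: "f \<in> hom C X Y \<Longrightarrow> \<tau> Y \<cdot>\<^bsub>D\<^esub> amap S f = amap T f \<cdot>\<^bsub>D\<^esub> \<tau> X"

locale adjunction = F: cat_functor C D F + G: cat_functor D C G
    + unit: nat_trans C C id_functor "G \<circ>\<^sub>F F" \<eta>
    + counit: nat_trans D D "F \<circ>\<^sub>F G" id_functor \<epsilon>
  for C :: "('o, 'a) category_data" and D :: "('p, 'b) category_data"
    and F :: "('o, 'a, 'p, 'b) functor_data" and G :: "('p, 'b, 'o, 'a) functor_data"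
    and \<eta> :: "'o \<Rightarrow> 'a" and \<epsilon> :: "'p \<Rightarrow> 'b" +
  assumes triangle_F: "X \<in> Obj C \<Longrightarrow> \<epsilon> (omap F X) \<cdot>\<^bsub>D\<^esub> amap F (\<eta> X) = Ident D (omap F X)"
    and triangle_G: "Y \<in> Obj D \<Longrightarrow> amap G (\<epsilon> Y) \<cdot>\<^bsub>C\<^esub> \<eta> (omap G Y) = Ident C (omap G Y)"

text \<open>The direction \<open>\<C>(X, G Y) \<rightarrow> \<D>(F X, Y)\<close> of adjoint transposition; the codomain \<open>Y\<close> is an
  explicit argument because \<open>f\<close> only determines \<open>G Y\<close>.\<close>

definition adj_transpose ::
  "('p, 'b) category_data \<Rightarrow> ('o, 'a, 'p, 'b) functor_data \<Rightarrow> ('p \<Rightarrow> 'b) \<Rightarrow> 'p \<Rightarrow> 'a \<Rightarrow> 'b" where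
  "adj_transpose D F \<epsilon> Y f = \<epsilon> Y \<cdot>\<^bsub>D\<^esub> amap F f"

text \<open>The mate \<open>\<rho>\<^sub>2 = \<epsilon>LF \<circ> F\<rho>F \<circ> FH\<eta> : FH \<Rightarrow> LF\<close> of \<open>\<rho> : HG \<Rightarrow> GL\<close>.\<close>

definition mate ::
  "('p, 'b) category_data \<Rightarrow> ('o, 'a, 'p, 'b) functor_data \<Rightarrow> ('o \<Rightarrow> 'a) \<Rightarrow> ('p \<Rightarrow> 'b) \<Rightarrow>
   ('o, 'a, 'o, 'a) functor_data \<Rightarrow> ('p, 'b, 'p, 'b) functor_data \<Rightarrow> ('p \<Rightarrow> 'a) \<Rightarrow> 'o \<Rightarrow> 'b" where
  "mate D F \<eta> \<epsilon> H L \<rho> X =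
     \<epsilon> (omap L (omap F X)) \<cdot>\<^bsub>D\<^esub> amap F (\<rho> (omap F X)) \<cdot>\<^bsub>D\<^esub> amap F (amap H (\<eta> X))"


definition coalgebra ::
  "('o, 'a) category_data \<Rightarrow> ('o, 'a, 'o, 'a) functor_data \<Rightarrow> 'o \<Rightarrow> 'a \<Rightarrow> bool" where
  "coalgebra C K X c \<longleftrightarrow> X \<in> Obj C \<and> c \<in> hom C X (omap K X)"

definition algebra ::
  "('o, 'a) category_data \<Rightarrow> ('o, 'a, 'o, 'a) functor_data \<Rightarrow> 'o \<Rightarrow> 'a \<Rightarrow> bool" where
  "algebra C K A a \<longleftrightarrow> A \<in> Obj C \<and> a \<in> hom C (omap K A) A"

definition coalgebra_hom ::
  "('o, 'a) category_data \<Rightarrow> ('o, 'a, 'o, 'a) functor_data \<Rightarrow> 'o \<Rightarrow> 'a \<Rightarrow> 'o \<Rightarrow> 'a \<Rightarrow> 'a \<Rightarrow> bool"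
  where
  "coalgebra_hom C K X c Y d f \<longleftrightarrow> coalgebra C K X c \<and> coalgebra C K Y d \<and>
     f \<in> hom C X Y \<and> d \<cdot>\<^bsub>C\<^esub> f = amap K f \<cdot>\<^bsub>C\<^esub> c"

definition final_coalgebra ::
  "('o, 'a) category_data \<Rightarrow> ('o, 'a, 'o, 'a) functor_data \<Rightarrow> 'o \<Rightarrow> 'a \<Rightarrow> bool" where
  "final_coalgebra C K Z z \<longleftrightarrow> coalgebra C K Z z \<and>
     (\<forall>X c. coalgebra C K X c \<longrightarrow> (\<exists>!f. coalgebra_hom C K X c Z z f))"

definition coalgebra_to_algebra ::
  "('o, 'a) category_data \<Rightarrow> ('o, 'a, 'o, 'a) functor_data \<Rightarrow> 'o \<Rightarrow> 'a \<Rightarrow> 'o \<Rightarrow> 'a \<Rightarrow> 'a \<Rightarrow> bool"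
  where
  "coalgebra_to_algebra C K X c A a f \<longleftrightarrow> coalgebra C K X c \<and> algebra C K A a \<and>
     f \<in> hom C X A \<and> f = a \<cdot>\<^bsub>C\<^esub> amap K f \<cdot>\<^bsub>C\<^esub> c"


lemma (in category) homD: "f \<in> hom C X Y \<Longrightarrow> X \<in> Obj C \<and> Y \<in> Obj C"
  using Dom_obj Cod_obj by (auto simp: hom_def)

lemma (in category) inverse_arrows_unique:
  assumes "inverse_arrows C f g" "inverse_arrows C f h"
  shows "g = h"
proof -
  from assms(1) obtain X Y where 1: "f \<in> hom C X Y" "g \<in> hom C Y X"
      "g \<cdot> f = Ident C X" "f \<cdot> g = Ident C Y"
    by (auto simp: inverse_arrows_def)
  from assms(2) 1(1) have 2: "h \<in> hom C Y X" "h \<cdot> f = Ident C X" "f \<cdot> h = Ident C Y"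
    by (auto simp: inverse_arrows_def hom_def)
  have "g = g \<cdot> (f \<cdot> h)" using 1(2) 2(3) by (simp add: comp_ident)
  also have "\<dots> = (g \<cdot> f) \<cdot> h" using comp_assoc[OF 2(1) 1(1) 1(2)] by simp
  also have "\<dots> = h" using 1(3) 2(1) by (simp add: ident_comp)
  finally show ?thesis .
qed

lemma (in category) inv_arr:
  assumes "iso C f"
  shows "inverse_arrows C f (inv_arr C f)"
  using assms inverse_arrows_unique theI[of "inverse_arrows C f"]
  unfolding iso_def inv_arr_def by blast

text \<open>Lambek's lemma: the structure map of a final coalgebra is an isomorphism, so that
  \<^const>\<open>inv_arr\<close> is meaningful for it.\<close>

lemma final_coalgebra_iso:
  assumes "cat_functor C C K" "final_coalgebra C K Z z"
  shows "iso C z"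
proof -
  interpret K: cat_functor C C K by fact
  let ?KZ = "omap K Z"
  have cZ: "coalgebra C K Z z"
    and fin: "\<And>X c. coalgebra C K X c \<Longrightarrow> \<exists>!f. coalgebra_hom C K X c Z z f"
    using assms(2) by (auto simp: final_coalgebra_def)
  have Z: "Z \<in> Obj C" and z: "z \<in> hom C Z ?KZ" using cZ by (auto simp: coalgebra_def)
  have Kz: "amap K z \<in> hom C ?KZ (omap K ?KZ)" using K.amap_hom[OF z] .
  have cKZ: "coalgebra C K ?KZ (amap K z)"
    using Kz K.omap_obj[OF Z] by (simp add: coalgebra_def)
  obtain g where g: "coalgebra_hom C K ?KZ (amap K z) Z z g" using fin[OF cKZ] by blast
  have gh: "g \<in> hom C ?KZ Z" and geq: "z \<cdot>\<^bsub>C\<^esub> g = amap K g \<cdot>\<^bsub>C\<^esub> amap K z"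
    using g by (auto simp: coalgebra_hom_def)
  have Kg: "amap K g \<in> hom C (omap K ?KZ) ?KZ" using K.amap_hom[OF gh] .
  have gz: "g \<cdot>\<^bsub>C\<^esub> z \<in> hom C Z Z" using K.C.comp_hom[OF z gh] .
  have "z \<cdot>\<^bsub>C\<^esub> (g \<cdot>\<^bsub>C\<^esub> z) = (z \<cdot>\<^bsub>C\<^esub> g) \<cdot>\<^bsub>C\<^esub> z"
    using K.C.comp_assoc[OF z gh z] by simp
  also have "\<dots> = amap K (g \<cdot>\<^bsub>C\<^esub> z) \<cdot>\<^bsub>C\<^esub> z"
    using geq K.amap_comp[OF z gh] by simp
  finally have "coalgebra_hom C K Z z Z z (g \<cdot>\<^bsub>C\<^esub> z)"
    using cZ gz by (simp add: coalgebra_hom_def)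
  moreover have "coalgebra_hom C K Z z Z z (Ident C Z)"
    using cZ Z z K.C.ident_hom[OF Z] K.amap_ident[OF Z] K.C.comp_ident[OF z] K.C.ident_comp[OF z]
    by (simp add: coalgebra_hom_def)
  ultimately have 1: "g \<cdot>\<^bsub>C\<^esub> z = Ident C Z" using fin[OF cZ] by blast
  have "z \<cdot>\<^bsub>C\<^esub> g = amap K (g \<cdot>\<^bsub>C\<^esub> z)" using geq K.amap_comp[OF z gh] by simp
  then have "z \<cdot>\<^bsub>C\<^esub> g = Ident C ?KZ" using 1 K.amap_ident[OF Z] by simp
  with 1 z gh show ?thesis by (auto simp: iso_def inverse_arrows_def)
qed

lemma (in adjunction) adj_transpose_bij:
  assumes X: "X \<in> Obj C" and Y: "Y \<in> Obj D"
  shows "bij_betw (adj_transpose D F \<epsilon> Y) (hom C X (omap G Y)) (hom D (omap F X) Y)"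
proof (rule bij_betw_byWitness[where f' = "\<lambda>g. amap G g \<cdot>\<^bsub>C\<^esub> \<eta> X"])
  have eps: "\<epsilon> Y \<in> hom D (omap F (omap G Y)) Y"
    using counit.component_hom[OF Y] by (simp add: comp_functor_def id_functor_def)
  have eta: "\<eta> X \<in> hom C X (omap G (omap F X))"
    using unit.component_hom[OF X] by (simp add: comp_functor_def id_functor_def)
  show "\<forall>f\<in>hom C X (omap G Y). amap G (adj_transpose D F \<epsilon> Y f) \<cdot>\<^bsub>C\<^esub> \<eta> X = f"
  proof
    fix f assume f: "f \<in> hom C X (omap G Y)"
    have Ff: "amap F f \<in> hom D (omap F X) (omap F (omap G Y))" using F.amap_hom[OF f] .
    have "amap G (adj_transpose D F \<epsilon> Y f) \<cdot>\<^bsub>C\<^esub> \<eta> X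
        = amap G (\<epsilon> Y) \<cdot>\<^bsub>C\<^esub> (amap G (amap F f) \<cdot>\<^bsub>C\<^esub> \<eta> X)"
      using G.amap_comp[OF Ff eps] F.C.comp_assoc[OF eta G.amap_hom[OF Ff] G.amap_hom[OF eps]]
      by (simp add: adj_transpose_def)
    also have "amap G (amap F f) \<cdot>\<^bsub>C\<^esub> \<eta> X = \<eta> (omap G Y) \<cdot>\<^bsub>C\<^esub> f"
      using unit.naturality[OF f] by (simp add: comp_functor_def id_functor_def)
    also have "amap G (\<epsilon> Y) \<cdot>\<^bsub>C\<^esub> (\<eta> (omap G Y) \<cdot>\<^bsub>C\<^esub> f) = f"
      using F.C.comp_assoc[OF f _ G.amap_hom[OF eps], of "\<eta> (omap G Y)"]
        unit.component_hom[OF G.omap_obj[OF Y]] triangle_G[OF Y] F.C.ident_comp[OF f]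
      by (simp add: comp_functor_def id_functor_def)
    finally show "amap G (adj_transpose D F \<epsilon> Y f) \<cdot>\<^bsub>C\<^esub> \<eta> X = f" .
  qed
  show "\<forall>g\<in>hom D (omap F X) Y. adj_transpose D F \<epsilon> Y (amap G g \<cdot>\<^bsub>C\<^esub> \<eta> X) = g"
  proof
    fix g assume g: "g \<in> hom D (omap F X) Y"
    have Gg: "amap G g \<in> hom C (omap G (omap F X)) (omap G Y)" using G.amap_hom[OF g] .
    have "adj_transpose D F \<epsilon> Y (amap G g \<cdot>\<^bsub>C\<^esub> \<eta> X)
        = (\<epsilon> Y \<cdot>\<^bsub>D\<^esub> amap F (amap G g)) \<cdot>\<^bsub>D\<^esub> amap F (\<eta> X)"
      using F.amap_comp[OF eta Gg] F.D.comp_assoc[OF F.amap_hom[OF eta] F.amap_hom[OF Gg] eps]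
      by (simp add: adj_transpose_def)
    also have "\<epsilon> Y \<cdot>\<^bsub>D\<^esub> amap F (amap G g) = g \<cdot>\<^bsub>D\<^esub> \<epsilon> (omap F X)"
      using counit.naturality[OF g] by (simp add: comp_functor_def id_functor_def)
    also have "(g \<cdot>\<^bsub>D\<^esub> \<epsilon> (omap F X)) \<cdot>\<^bsub>D\<^esub> amap F (\<eta> X) = g"
      using F.D.comp_assoc[OF F.amap_hom[OF eta] _ g, of "\<epsilon> (omap F X)"]
        counit.component_hom[OF F.omap_obj[OF X]] triangle_F[OF X] F.D.comp_ident[OF g]
      by (simp add: comp_functor_def id_functor_def)
    finally show "adj_transpose D F \<epsilon> Y (amap G g \<cdot>\<^bsub>C\<^esub> \<eta> X) = g" .
  qed
  show "adj_transpose D F \<epsilon> Y ` hom C X (omap G Y) \<subseteq> hom D (omap F X) Y"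
    using F.D.comp_hom[OF F.amap_hom eps] by (auto simp: adj_transpose_def)
  show "(\<lambda>g. amap G g \<cdot>\<^bsub>C\<^esub> \<eta> X) ` hom D (omap F X) Y \<subseteq> hom C X (omap G Y)"
    using F.C.comp_hom[OF eta G.amap_hom] by auto
qed

end

theory Submission
  imports Defs
begin

text \<open>Transposition is a bijection \<open>\<C>(X, G \<Psi>) \<cong> \<D>(F X, \<Psi>)\<close>, and by its naturality together with
  naturality of \<open>\<rho>\<close> it conjugates the operator \<open>f \<mapsto> G(\<alpha>) \<circ> \<rho> \<circ> H f \<circ> c\<close> to the operator
  \<open>g \<mapsto> \<alpha> \<circ> L g \<circ> \<rho>\<^sub>2 \<circ> F c\<close>. Hence it restricts to a bijection between fixed points, that is, between
  coalgebra-to-algebra morphisms. For \<open>\<alpha> = \<zeta>\<^sup>-\<^sup>1\<close> the fixed points in \<open>\<D>\<close> are the coalgebra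
  homomorphisms into the final coalgebra, so there is exactly one.\<close>

text \<open>Composing with \<open>z\<close> on the left turns the fixed point equation into the
  homomorphism square, and composing with \<open>inv_arr C z\<close> turns it back. This is what
  makes finality applicable to coalgebra-to-algebra morphisms.\<close>

lemma coalgebra_to_algebra_inv_arr_iff:
  assumes "cat_functor C C K" and z: "coalgebra C K Z z" "iso C z"
  shows "coalgebra_to_algebra C K X c Z (inv_arr C z) f \<longleftrightarrow> coalgebra_hom C K X c Z z f"
proof -
  interpret K: cat_functor C C K by fact
  let ?i = "inv_arr C z"
  have zh: "z \<in> hom C Z (omap K Z)" and Z: "Z \<in> Obj C" using z(1) by (auto simp: coalgebra_def)
  have i: "?i \<in> hom C (omap K Z) Z" and iz: "?i \<cdot>\<^bsub>C\<^esub> z = Ident C Z"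
    and zi: "z \<cdot>\<^bsub>C\<^esub> ?i = Ident C (omap K Z)"
    using K.C.inv_arr[OF z(2)] zh by (auto simp: inverse_arrows_def hom_def)
  \<comment> \<open>The typings of \<open>c\<close> and \<open>f\<close> belong to both predicates,
    so only the two equations remain to be compared.\<close>
  have "f = ?i \<cdot>\<^bsub>C\<^esub> amap K f \<cdot>\<^bsub>C\<^esub> c \<longleftrightarrow> z \<cdot>\<^bsub>C\<^esub> f = amap K f \<cdot>\<^bsub>C\<^esub> c"
    if c: "c \<in> hom C X (omap K X)" and f: "f \<in> hom C X Z"
  proof -
    have Kfc: "amap K f \<cdot>\<^bsub>C\<^esub> c \<in> hom C X (omap K Z)" using K.C.comp_hom[OF c K.amap_hom[OF f]] .
    show ?thesis
      using K.C.comp_assoc[OF f zh i] K.C.comp_assoc[OF Kfc i zh] iz zi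
        K.C.ident_comp[OF f] K.C.ident_comp[OF Kfc]
      by metis
  qed
  then show ?thesis
    using z(1) Z i by (auto simp: coalgebra_to_algebra_def coalgebra_hom_def coalgebra_def algebra_def)
qed

context adjunction
begin

lemma counit_hom: "Y \<in> Obj D \<Longrightarrow> \<epsilon> Y \<in> hom D (omap F (omap G Y)) Y"
  using counit.component_hom by (simp add: comp_functor_def id_functor_def)

lemma unit_hom: "X \<in> Obj C \<Longrightarrow> \<eta> X \<in> hom C X (omap G (omap F X))"
  using unit.component_hom by (simp add: comp_functor_def id_functor_def)

lemma adj_transpose_hom:
  assumes "Y \<in> Obj D" "f \<in> hom C X (omap G Y)"
  shows "adj_transpose D F \<epsilon> Y f \<in> hom D (omap F X) Y"
  unfolding adj_transpose_def
  using F.D.comp_hom[OF F.amap_hom[OF assms(2)] counit_hom[OF assms(1)]] .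

text \<open>Naturality of transposition in its \<open>C\<close>-argument; it comes from
  functoriality of \<open>F\<close>.\<close>

lemma adj_transpose_precomp:
  assumes Y: "Y \<in> Obj D" and k: "k \<in> hom C W X" and h: "h \<in> hom C X (omap G Y)"
  shows "adj_transpose D F \<epsilon> Y (h \<cdot>\<^bsub>C\<^esub> k) = adj_transpose D F \<epsilon> Y h \<cdot>\<^bsub>D\<^esub> amap F k"
  using F.D.comp_assoc[OF F.amap_hom[OF k] F.amap_hom[OF h] counit_hom[OF Y]] F.amap_comp[OF k h]
  by (simp add: adj_transpose_def)

text \<open>Naturality of transposition in its \<open>D\<close>-argument; here naturality of the
  counit moves \<alpha> out of \<open>F\<close> and \<open>G\<close>.\<close>

lemma adj_transpose_postcomp:
  assumes h: "h \<in> hom C X (omap G Y)" and \<alpha>: "\<alpha> \<in> hom D Y Z"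
  shows "adj_transpose D F \<epsilon> Z (amap G \<alpha> \<cdot>\<^bsub>C\<^esub> h) = \<alpha> \<cdot>\<^bsub>D\<^esub> adj_transpose D F \<epsilon> Y h"
proof -
  have Y: "Y \<in> Obj D" and Z: "Z \<in> Obj D" using F.D.homD[OF \<alpha>] by auto
  note G\<alpha> = G.amap_hom[OF \<alpha>]
  have "adj_transpose D F \<epsilon> Z (amap G \<alpha> \<cdot>\<^bsub>C\<^esub> h)
      = (\<epsilon> Z \<cdot>\<^bsub>D\<^esub> amap F (amap G \<alpha>)) \<cdot>\<^bsub>D\<^esub> amap F h"
    using adj_transpose_precomp[OF Z h G\<alpha>] by (simp add: adj_transpose_def)
  also have "\<epsilon> Z \<cdot>\<^bsub>D\<^esub> amap F (amap G \<alpha>) = \<alpha> \<cdot>\<^bsub>D\<^esub> \<epsilon> Y"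
    using counit.naturality[OF \<alpha>] by (simp add: comp_functor_def id_functor_def)
  also have "(\<alpha> \<cdot>\<^bsub>D\<^esub> \<epsilon> Y) \<cdot>\<^bsub>D\<^esub> amap F h = \<alpha> \<cdot>\<^bsub>D\<^esub> adj_transpose D F \<epsilon> Y h"
    using F.D.comp_assoc[OF F.amap_hom[OF h] counit_hom[OF Y] \<alpha>] by (simp add: adj_transpose_def)
  finally show ?thesis .
qed

text \<open>By naturality of the unit and a triangle identity, transposition has an explicit left
  inverse. It serves both to factor \<open>f\<close> through the unit and to cancel transposes in
  equations.\<close>

lemma adj_transpose_inverse:
  assumes Y: "Y \<in> Obj D" and f: "f \<in> hom C X (omap G Y)"
  shows "amap G (adj_transpose D F \<epsilon> Y f) \<cdot>\<^bsub>C\<^esub> \<eta> X = f"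
proof -
  have X: "X \<in> Obj C" using F.C.homD[OF f] by blast
  note Ff = F.amap_hom[OF f] and eps = counit_hom[OF Y] and GY = G.omap_obj[OF Y]
  have "amap G (adj_transpose D F \<epsilon> Y f) \<cdot>\<^bsub>C\<^esub> \<eta> X
      = amap G (\<epsilon> Y) \<cdot>\<^bsub>C\<^esub> amap G (amap F f) \<cdot>\<^bsub>C\<^esub> \<eta> X"
    using G.amap_comp[OF Ff eps]
      F.C.comp_assoc[OF unit_hom[OF X] G.amap_hom[OF Ff] G.amap_hom[OF eps]]
    by (simp add: adj_transpose_def)
  also have "\<dots> = amap G (\<epsilon> Y) \<cdot>\<^bsub>C\<^esub> \<eta> (omap G Y) \<cdot>\<^bsub>C\<^esub> f"
    using unit.naturality[OF f] by (simp add: comp_functor_def id_functor_def)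
  also have "\<dots> = f"
    using F.C.comp_assoc[OF f unit_hom[OF GY] G.amap_hom[OF eps]] triangle_G[OF Y]
      F.C.ident_comp[OF f]
    by simp
  finally show ?thesis .
qed

end

text \<open>Here \<rho> lifts \<open>G\<close> from \<open>L\<close>-algebras to
  \<open>H\<close>-algebras, sending \<alpha> on \<open>Y\<close> to
  \<open>amap G \<alpha> \<cdot> \<rho> Y\<close>. Its mate lifts \<open>F\<close> from
  \<open>H\<close>-coalgebras to \<open>L\<close>-coalgebras.\<close>

locale adjunction_step = adjunction C D F G \<eta> \<epsilon>
    + H: cat_functor C C H + L: cat_functor D D L
    + \<rho>: nat_trans D C "H \<circ>\<^sub>F G" "G \<circ>\<^sub>F L" \<rho>
  for C :: "('o, 'a) category_data" and D :: "('p, 'b) category_data"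
    and F :: "('o, 'a, 'p, 'b) functor_data" and G :: "('p, 'b, 'o, 'a) functor_data"
    and \<eta> :: "'o \<Rightarrow> 'a" and \<epsilon> :: "'p \<Rightarrow> 'b"
    and H :: "('o, 'a, 'o, 'a) functor_data" and L :: "('p, 'b, 'p, 'b) functor_data"
    and \<rho> :: "'p \<Rightarrow> 'a"
begin

abbreviation transpose :: "'p \<Rightarrow> 'a \<Rightarrow> 'b" where
  "transpose \<equiv> adj_transpose D F \<epsilon>"

abbreviation \<rho>\<^sub>2 :: "'o \<Rightarrow> 'b" where
  "\<rho>\<^sub>2 \<equiv> mate D F \<eta> \<epsilon> H L \<rho>"

lemma step_hom: "Y \<in> Obj D \<Longrightarrow> \<rho> Y \<in> hom C (omap H (omap G Y)) (omap G (omap L Y))"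
  using \<rho>.component_hom by (simp add: comp_functor_def)

lemma step_naturality:
  "g \<in> hom D Y Z \<Longrightarrow> \<rho> Z \<cdot>\<^bsub>C\<^esub> amap H (amap G g) = amap G (amap L g) \<cdot>\<^bsub>C\<^esub> \<rho> Y"
  using \<rho>.naturality by (simp add: comp_functor_def)

lemma step_unit_hom:
  assumes "X \<in> Obj C"
  shows "\<rho> (omap F X) \<cdot>\<^bsub>C\<^esub> amap H (\<eta> X) \<in> hom C (omap H X) (omap G (omap L (omap F X)))"
  using F.C.comp_hom[OF H.amap_hom[OF unit_hom[OF assms]] step_hom[OF F.omap_obj[OF assms]]] .

text \<open>Functoriality merges the two factors under \<open>F\<close>. In this form the naturality
  laws of transposition apply to the mate.\<close>

lemma mate_eq_transpose:
  assumes X: "X \<in> Obj C"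
  shows "\<rho>\<^sub>2 X = transpose (omap L (omap F X)) (\<rho> (omap F X) \<cdot>\<^bsub>C\<^esub> amap H (\<eta> X))"
  using F.amap_comp[OF H.amap_hom[OF unit_hom[OF X]] step_hom[OF F.omap_obj[OF X]]]
  by (simp add: mate_def adj_transpose_def)

lemma mate_hom:
  assumes X: "X \<in> Obj C"
  shows "\<rho>\<^sub>2 X \<in> hom D (omap F (omap H X)) (omap L (omap F X))"
  unfolding mate_eq_transpose[OF X]
  using adj_transpose_hom[OF L.omap_obj[OF F.omap_obj[OF X]] step_unit_hom[OF X]] .

text \<open>The link between \<rho> and its mate: factor \<open>f\<close> as
  \<open>amap G ?g\<close> after the unit, let naturality of \<rho> turn
  \<open>amap H (amap G ?g)\<close> into \<open>amap G (amap L ?g)\<close>, and transpose. The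
  factor \<open>amap L ?g\<close> comes out in front, and what is left is the transpose that defines
  the mate.\<close>

lemma transpose_step:
  assumes Y: "Y \<in> Obj D" and f: "f \<in> hom C X (omap G Y)"
  shows "transpose (omap L Y) (\<rho> Y \<cdot>\<^bsub>C\<^esub> amap H f) = amap L (transpose Y f) \<cdot>\<^bsub>D\<^esub> \<rho>\<^sub>2 X"
proof -
  let ?g = "transpose Y f"
  have X: "X \<in> Obj C" using F.C.homD[OF f] by blast
  note g = adj_transpose_hom[OF Y f] and FX = F.omap_obj[OF X]
  note Gg = G.amap_hom[OF g] and Lg = L.amap_hom[OF g] and H\<eta> = H.amap_hom[OF unit_hom[OF X]]
  have "\<rho> Y \<cdot>\<^bsub>C\<^esub> amap H f = \<rho> Y \<cdot>\<^bsub>C\<^esub> amap H (amap G ?g) \<cdot>\<^bsub>C\<^esub> amap H (\<eta> X)"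
    using adj_transpose_inverse[OF Y f] H.amap_comp[OF unit_hom[OF X] Gg] by simp
  also have "\<dots> = amap G (amap L ?g) \<cdot>\<^bsub>C\<^esub> \<rho> (omap F X) \<cdot>\<^bsub>C\<^esub> amap H (\<eta> X)"
    using F.C.comp_assoc[OF H\<eta> H.amap_hom[OF Gg] step_hom[OF Y]] step_naturality[OF g]
      F.C.comp_assoc[OF H\<eta> step_hom[OF FX] G.amap_hom[OF Lg]]
    by simp
  finally show ?thesis
    using adj_transpose_postcomp[OF step_unit_hom[OF X] Lg] mate_eq_transpose[OF X] by simp
qed

text \<open>Transposition intertwines the operators whose fixed points are the two kinds of
  morphism. Being injective, it also reflects fixed points.\<close>

lemma transpose_coalgebra_to_algebra_iff:
  assumes c: "coalgebra C H X c" and \<alpha>: "algebra D L Y \<alpha>" and f: "f \<in> hom C X (omap G Y)"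
  shows "coalgebra_to_algebra C H X c (omap G Y) (amap G \<alpha> \<cdot>\<^bsub>C\<^esub> \<rho> Y) f \<longleftrightarrow>
    coalgebra_to_algebra D L (omap F X) (\<rho>\<^sub>2 X \<cdot>\<^bsub>D\<^esub> amap F c) Y \<alpha> (transpose Y f)"
proof -
  have X: "X \<in> Obj C" and ch: "c \<in> hom C X (omap H X)" using c by (auto simp: coalgebra_def)
  have Y: "Y \<in> Obj D" and \<alpha>h: "\<alpha> \<in> hom D (omap L Y) Y" using \<alpha> by (auto simp: algebra_def)
  note LY = L.omap_obj[OF Y] and g = adj_transpose_hom[OF Y f]
  note Hf = H.amap_hom[OF f] and \<rho>h = step_hom[OF Y] and G\<alpha> = G.amap_hom[OF \<alpha>h]
    and Fc = F.amap_hom[OF ch]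
  let ?\<Phi>f = "(amap G \<alpha> \<cdot>\<^bsub>C\<^esub> \<rho> Y) \<cdot>\<^bsub>C\<^esub> amap H f \<cdot>\<^bsub>C\<^esub> c"
  have Hfc: "amap H f \<cdot>\<^bsub>C\<^esub> c \<in> hom C X (omap H (omap G Y))" using F.C.comp_hom[OF ch Hf] .
  have a: "amap G \<alpha> \<cdot>\<^bsub>C\<^esub> \<rho> Y \<in> hom C (omap H (omap G Y)) (omap G Y)"
    using F.C.comp_hom[OF \<rho>h G\<alpha>] .
  have \<Phi>f: "?\<Phi>f \<in> hom C X (omap G Y)" using F.C.comp_hom[OF Hfc a] .
  have \<rho>Hf: "\<rho> Y \<cdot>\<^bsub>C\<^esub> amap H f \<in> hom C (omap H X) (omap G (omap L Y))"
    using F.C.comp_hom[OF Hf \<rho>h] .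
  \<comment> \<open>Rebracketed so that \<alpha> splits off by postcomposition and \<open>c\<close>
    by precomposition, with exactly the composite treated by \<open>transpose_step\<close> in
    between.\<close>
  have "?\<Phi>f = amap G \<alpha> \<cdot>\<^bsub>C\<^esub> (\<rho> Y \<cdot>\<^bsub>C\<^esub> amap H f) \<cdot>\<^bsub>C\<^esub> c"
    using F.C.comp_assoc[OF Hfc \<rho>h G\<alpha>] F.C.comp_assoc[OF ch Hf \<rho>h] by simp
  then have "transpose Y ?\<Phi>f = \<alpha> \<cdot>\<^bsub>D\<^esub> (amap L (transpose Y f) \<cdot>\<^bsub>D\<^esub> \<rho>\<^sub>2 X) \<cdot>\<^bsub>D\<^esub> amap F c"
    using adj_transpose_postcomp[OF F.C.comp_hom[OF ch \<rho>Hf] \<alpha>h]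
      adj_transpose_precomp[OF LY ch \<rho>Hf] transpose_step[OF Y f]
    by simp
  also have "\<dots> = \<alpha> \<cdot>\<^bsub>D\<^esub> amap L (transpose Y f) \<cdot>\<^bsub>D\<^esub> \<rho>\<^sub>2 X \<cdot>\<^bsub>D\<^esub> amap F c"
    using F.D.comp_assoc[OF Fc mate_hom[OF X] L.amap_hom[OF g]] by simp
  finally have conj: "transpose Y ?\<Phi>f = \<dots>" .
  \<comment> \<open>Transposition is injective because of its left inverse.\<close>
  have "f = ?\<Phi>f \<longleftrightarrow> transpose Y f = transpose Y ?\<Phi>f"
    using adj_transpose_inverse[OF Y f] adj_transpose_inverse[OF Y \<Phi>f] by metis
  then show ?thesis
    using c \<alpha> f g a conj F.D.comp_hom[OF Fc mate_hom[OF X]] F.omap_obj[OF X] G.omap_obj[OF Y]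
    by (simp add: coalgebra_to_algebra_def coalgebra_def algebra_def)
qed

end

theorem theorem2p6:
  fixes C :: "('o, 'a) category_data" and D :: "('p, 'b) category_data"
    and F :: "('o, 'a, 'p, 'b) functor_data" and G :: "('p, 'b, 'o, 'a) functor_data"
    and \<eta> :: "'o \<Rightarrow> 'a" and \<epsilon> :: "'p \<Rightarrow> 'b"
    and H :: "('o, 'a, 'o, 'a) functor_data" and L :: "('p, 'b, 'p, 'b) functor_data"
    and \<rho> :: "'p \<Rightarrow> 'a" and \<Psi> :: 'p and \<zeta> :: 'b
  assumes "adjunction C D F G \<eta> \<epsilon>"
    and "cat_functor C C H"
    and "cat_functor D D L"
    and "nat_trans D C (H \<circ>\<^sub>F G) (G \<circ>\<^sub>F L) \<rho>"
    and "final_coalgebra D L \<Psi> \<zeta>"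
  shows "\<forall>X c. coalgebra C H X c \<longrightarrow>
    (\<exists>!f. coalgebra_to_algebra C H X c (omap G \<Psi>) (amap G (inv_arr D \<zeta>) \<cdot>\<^bsub>C\<^esub> \<rho> \<Psi>) f) \<and>
    (\<forall>cd. coalgebra_to_algebra C H X c (omap G \<Psi>) (amap G (inv_arr D \<zeta>) \<cdot>\<^bsub>C\<^esub> \<rho> \<Psi>) cd \<longrightarrow>
      (\<forall>g. coalgebra_to_algebra D L (omap F X) (mate D F \<eta> \<epsilon> H L \<rho> X \<cdot>\<^bsub>D\<^esub> amap F c) \<Psi> (inv_arr D \<zeta>) g
        \<longleftrightarrow> g = adj_transpose D F \<epsilon> \<Psi> cd) \<and>
      (\<forall>g. coalgebra_hom D L (omap F X) (mate D F \<eta> \<epsilon> H L \<rho> X \<cdot>\<^bsub>D\<^esub> amap F c) \<Psi> \<zeta> g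
        \<longleftrightarrow> g = adj_transpose D F \<epsilon> \<Psi> cd))"
proof (intro allI impI)
  fix X c
  assume c: "coalgebra C H X c"
  interpret adjunction_step C D F G \<eta> \<epsilon> H L \<rho>
    using assms(1-4) by (simp add: adjunction_step_def)
  have z: "coalgebra D L \<Psi> \<zeta>" using assms(5) by (simp add: final_coalgebra_def)
  have iso: "iso D \<zeta>" using final_coalgebra_iso[OF assms(3,5)] .
  have X: "X \<in> Obj C" and ch: "c \<in> hom C X (omap H X)" using c by (auto simp: coalgebra_def)
  have \<Psi>: "\<Psi> \<in> Obj D" using z by (simp add: coalgebra_def)
  have "inv_arr D \<zeta> \<in> hom D (omap L \<Psi>) \<Psi>"
    using F.D.inv_arr[OF iso] z by (auto simp: inverse_arrows_def coalgebra_def hom_def)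
  then have alg: "algebra D L \<Psi> (inv_arr D \<zeta>)" using \<Psi> by (simp add: algebra_def)
  let ?P = "coalgebra_to_algebra C H X c (omap G \<Psi>) (amap G (inv_arr D \<zeta>) \<cdot>\<^bsub>C\<^esub> \<rho> \<Psi>)"
  let ?d = "\<rho>\<^sub>2 X \<cdot>\<^bsub>D\<^esub> amap F c"
  let ?Q = "coalgebra_to_algebra D L (omap F X) ?d \<Psi> (inv_arr D \<zeta>)"
  let ?R = "coalgebra_hom D L (omap F X) ?d \<Psi> \<zeta>"
  have QR: "?Q g \<longleftrightarrow> ?R g" for g
    using coalgebra_to_algebra_inv_arr_iff[OF assms(3) z iso] .
  have PQ: "?P f \<longleftrightarrow> ?Q (transpose \<Psi> f)" if "f \<in> hom C X (omap G \<Psi>)" for f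
    using transpose_coalgebra_to_algebra_iff[OF c alg that] .
  have Phom: "f \<in> hom C X (omap G \<Psi>)" if "?P f" for f
    using that by (simp add: coalgebra_to_algebra_def)
  have "coalgebra D L (omap F X) ?d"
    using F.omap_obj[OF X] F.D.comp_hom[OF F.amap_hom[OF ch] mate_hom[OF X]]
    by (simp add: coalgebra_def)
  then have ex1: "\<exists>!g. ?R g" using assms(5) by (simp add: final_coalgebra_def)
  then obtain g where g: "?R g" by blast
  then have "g \<in> hom D (omap F X) \<Psi>" by (simp add: coalgebra_hom_def)
  \<comment> \<open>Existence: surjectivity of transposition pulls the homomorphism given by
    finality back to \<open>C\<close>.\<close>
  then obtain f where f: "f \<in> hom C X (omap G \<Psi>)" "g = transpose \<Psi> f"
    using adj_transpose_bij[OF X \<Psi>] by (auto simp: bij_betw_def)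
  have Pf: "?P f" using PQ[OF f(1)] QR g f(2) by simp
  \<comment> \<open>The transpose of any solution \<open>cd\<close> is itself a homomorphism into
    the final coalgebra, hence the only one.\<close>
  have R_iff: "?R g' \<longleftrightarrow> g' = transpose \<Psi> cd" if "?P cd" for cd g'
    using PQ[OF Phom[OF that]] QR that ex1 by blast
  \<comment> \<open>Uniqueness: \<open>f'\<close> and \<open>f\<close> both have transpose
    \<open>g\<close>, and the left inverse recovers each from it.\<close>
  have "f' = f" if "?P f'" for f'
    using R_iff[OF that] g f adj_transpose_inverse[OF \<Psi>] Phom[OF that] by metis
  with Pf have "\<exists>!f. ?P f" by blast
  with R_iff QR show "(\<exists>!f. ?P f) \<and> (\<forall>cd. ?P cd \<longrightarrow>
      (\<forall>g. ?Q g \<longleftrightarrow> g = transpose \<Psi> cd) \<and> (\<forall>g. ?R g \<longleftrightarrow> g = transpose \<Psi> cd))"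
    by blast
qed

end
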